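(* Let $k\ge 2$ and $s_1,\dots,s_k\in\mathbb{N}$ with all $s_i\ge 3$. Then $$m(s_1,\dots,s_k)\le \max\left\{\min_{i\in\{1,\dots,k\}}\prod_{j=0}^{s_i-3}\left\lceil\frac{(n_i-2)-j}{s_i-2}\right\rceil\right\},$$ where the maximum is taken over all $n_1,\dots,n_k\in\mathbb{N}$ satisfying: (1) $n_i\ge s_i$ for all $i$; (2) $n_1+\dots+n_k\le R(s_1,\dots,s_k)+2(k-1)$; (3) for all distinct $i,j$, writing $a\in\{i,j\}$ for an index with $n_a=\max\{n_i,n_j\}$ and $b$ for the other index, $|n_i-n_j|<R\bigl(s_a-1,\,R(s_\ell:\ell\neq a)\bigr)-(s_b-2)$.
   Context: $K_n$ is the complete graph on $n$ vertices. For $s_1,\dots,s_k\in\mathbb{N}$, the Ramsey number $R(s_1,\dots,s_k)$ is the smallest $n$ such that every coloring of the edges of $K_n$ with colors $\{1,\dots,k\}$ contains, for some $i$, a subgraph isomorphic to $K_{s_i}$ all of whose edges have color $i$ (a monochromatic $K_{s_i}$ in color $i$); for a single argument $R(s)=s$, and $R(s_\ell:\ell\ne a)$ is the Ramsey number of the list with $s_a$ removed. The critical multiplicity $m(s_1,\dots,s_k)$ is the largest $M$ such that every $k$-coloring of the edges of $K_{R(s_1,\dots,s_k)}$ contains at least $M$ subgraphs each of which, for some $i$, is isomorphic to $K_{s_i}$ and monochromatic in color $i$. *)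

theory Defs
  imports Complex_Main "HOL-Library.Ramsey"
begin

text \<open>
  The vertex set of \<open>K\<^sub>n\<close> is \<open>{..<n}\<close>, its edges are the two-element subsets of \<open>{..<n}\<close>, and
  the \<open>k\<close> colors, as well as the indices of the list \<open>s\<close> of clique sizes, are \<open>0, \<dots>, k - 1\<close>
  with \<open>k = length s\<close>.
\<close>

definition ramsey_number :: "nat list \<Rightarrow> nat" where
  "ramsey_number s = (LEAST n. partn_lst {..<n} s 2)"

definition edge_colorings :: "nat \<Rightarrow> nat \<Rightarrow> (nat set \<Rightarrow> nat) set" where
  "edge_colorings n k = [{..<n}]\<^bsup>2\<^esup> \<rightarrow> {..<k}"

text \<open>
  A subgraph is a pair of a vertex set and an edge set.  A subgraph with vertex set \<open>H\<close> is
  isomorphic to \<open>K\<^sub>m\<close> iff \<open>H\<close> has \<open>m\<close> elements and all pairs of vertices in \<open>H\<close> are edges of it.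
\<close>

definition monochromatic_subgraphs ::
    "nat \<Rightarrow> nat list \<Rightarrow> (nat set \<Rightarrow> nat) \<Rightarrow> (nat set \<times> nat set set) set" where
  "monochromatic_subgraphs n s f =
     {(H, E). \<exists>i<length s. H \<in> nsets {..<n} (s ! i) \<and> E = [H]\<^bsup>2\<^esup> \<and> f ` E \<subseteq> {i}}"

definition critical_multiplicity :: "nat list \<Rightarrow> nat" where
  "critical_multiplicity s =
     (GREATEST M. \<forall>f \<in> edge_colorings (ramsey_number s) (length s).
        M \<le> card (monochromatic_subgraphs (ramsey_number s) s f))"

definition remove_nth :: "nat \<Rightarrow> 'a list \<Rightarrow> 'a list" where
  "remove_nth a xs = take a xs @ drop (Suc a) xs"

text \<open>
  In case of a tie \<open>n ! i = n ! j\<close>, the separation condition is required for both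
  choices of \<open>a\<close>; it then holds automatically when all \<open>s ! i \<ge> 3\<close>.
\<close>

definition admissible_sizes :: "nat list \<Rightarrow> nat list set" where
  "admissible_sizes s =
     {n. length n = length s \<and>
         (\<forall>i<length s. n ! i \<ge> s ! i) \<and>
         sum_list n \<le> ramsey_number s + 2 * (length s - 1) \<and>
         (\<forall>i<length s. \<forall>j<length s. i \<noteq> j \<longrightarrow>
            (\<forall>a b. {a, b} = {i, j} \<and> n ! a = max (n ! i) (n ! j) \<longrightarrow>
               \<bar>int (n ! i) - int (n ! j)\<bar>
                 < int (ramsey_number [s ! a - 1, ramsey_number (remove_nth a s)])
                   - (int (s ! b) - 2)))}"

lemma partn_lst_ramsey_number: "partn_lst {..<ramsey_number s} s 2"
  unfolding ramsey_number_def using ramsey_full[of s 2] by (rule LeastI_ex)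

lemma ramsey_number_single: "ramsey_number [m] = m"
proof -
  have "partn_lst {..<n} [m] 2 \<longleftrightarrow> m \<le> n" for n
  proof
    assume "partn_lst {..<n} [m] 2"
    moreover have "(\<lambda>_. 0) \<in> [{..<n}]\<^bsup>2\<^esup> \<rightarrow> {..<length [m]}"
      by simp
    ultimately obtain H where "H \<in> [{..<n}]\<^bsup>m\<^esup>"
      unfolding partn_lst_def monochromatic_def by fastforce
    then show "m \<le> n"
      using card_mono[of "{..<n}" H] by (auto simp: nsets_def)
  next
    assume "m \<le> n"
    then have m: "{..<m} \<in> [{..<n}]\<^bsup>m\<^esup>"
      by (auto simp: nsets_def)
    moreover have "[{..<m}]\<^bsup>2\<^esup> \<subseteq> [{..<n}]\<^bsup>2\<^esup>"
      using \<open>m \<le> n\<close> by (intro nsets_mono) auto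
    ultimately show "partn_lst {..<n} [m] 2"
      unfolding partn_lst_def monochromatic_def by (auto simp: Pi_iff intro!: bexI[OF _ m])
  qed
  then show ?thesis
    unfolding ramsey_number_def by (auto intro: Least_equality)
qed

end

theory Submission
  imports Defs
begin

text \<open>
  Take a coloring of the complete graph on \<open>R - 1\<close> vertices without monochromatic cliques, where
  \<open>R\<close> is the Ramsey number, and duplicate a vertex \<open>v\<close>, giving the edge between \<open>v\<close> and its
  twin a color \<open>i\<close>.  The monochromatic cliques of the new coloring correspond to the color-\<open>i\<close>
  cliques of size \<open>s\<^sub>i - 2\<close> in the color-\<open>i\<close> neighborhood of \<open>v\<close>, which contains no such clique of
  size \<open>s\<^sub>i - 1\<close>; so their number is at most that of a Turan graph on the same vertices.  If \<open>d\<^sub>i\<close> is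
  the color-\<open>i\<close> degree of \<open>v\<close>, then the sizes \<open>n\<^sub>i = d\<^sub>i + 2\<close> are admissible: \<open>d\<^sub>i \<ge> s\<^sub>i - 2\<close> since
  the new coloring has some monochromatic clique for every choice of \<open>i\<close>, and \<open>d\<^sub>a\<close> is bounded by
  Ramsey's theorem for color \<open>a\<close> against the union of the other colors.
\<close>

section \<open>Turan-type bound on the number of cliques\<close>

text \<open>
  With \<open>b = (q + 1) / q\<close>, the convex function \<open>q b\<^bsup>x - q\<^esup>\<close> agrees with \<open>x\<close> at \<open>q\<close> and \<open>q + 1\<close>, so it
  dominates \<open>x\<close> at all natural numbers; multiplying over the factors gives the bound.
\<close>

lemma prod_le_balanced:
  fixes p :: "nat \<Rightarrow> nat"
  shows "(\<Prod>i<t. p i) \<le> (\<Prod>i<t. (sum p {..<t} + i) div t)"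
\<comment> \<open>The base \<open>b\<close> divides by \<open>q\<close>; a sum below
  \<open>t\<close> would make \<open>q\<close> zero, but then some factor is 0.\<close>
proof (cases "sum p {..<t} < t")
  case True
  have "\<exists>i<t. p i = 0"
  proof (rule ccontr)
    assume "\<not> ?thesis"
    then have "card {..<t} \<le> sum p {..<t}"
      by (subst card_eq_sum, intro sum_mono) (auto simp: Suc_le_eq)
    with True show False
      by simp
  qed
  then have "(\<Prod>i<t. p i) = 0"
    by (auto intro: prod_zero)
  then show ?thesis
    by (rule ord_eq_le_trans) simp
next
  case False
  define d where "d = sum p {..<t}"
  define q where "q = d div t"
  define r where "r = d mod t"
  show ?thesis
  proof (cases "t = 0")
    case True
    then show ?thesis by simp
  next
    case t: False
    have q: "q > 0"
      using False t by (simp add: q_def d_def div_greater_zero_iff)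
    have r: "r < t" and d: "d = q * t + r"
      using t by (simp_all add: r_def q_def)
    define b where "b = (real q + 1) / real q"
    have b: "b > 0"
      using q by (simp add: b_def)
    \<comment> \<open>\<open>up\<close> and \<open>down\<close> treat exponents above and below
      \<open>q\<close>; the power stays on the left in \<open>down\<close>, so no negative exponent
      occurs.\<close>
    have up: "real (q + j) \<le> real q * b ^ j" for j
    proof (induction j)
      case (Suc j)
      have "real (q + Suc j) \<le> real (q + j) * b"
        using q by (simp add: b_def field_simps)
      also have "\<dots> \<le> real q * b ^ Suc j"
        using mult_right_mono[OF Suc, of b] b by simp
      finally show ?case .
    qed simp
    have down: "(real q - real j) * b ^ j \<le> real q" for j
    proof (induction j)
      case (Suc j)
      have "(real q - real (Suc j)) * b \<le> real q - real j"
        using q by (simp add: b_def field_simps)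
      then have "(real q - real (Suc j)) * b ^ Suc j \<le> (real q - real j) * b ^ j"
        using mult_right_mono[of _ _ "b ^ j"] b by (fastforce simp: mult.assoc)
      with Suc show ?case
        by simp
    qed simp
    have tangent: "real x * b ^ q \<le> real q * b ^ x" for x
    proof (cases "q \<le> x")
      case True
      then show ?thesis
        using mult_right_mono[OF up[of "x - q"], of "b ^ q"] b
        by (simp add: mult.assoc flip: power_add)
    next
      case False
      then show ?thesis
        using mult_right_mono[OF down[of "q - x"], of "b ^ x"] b
        by (simp add: mult.assoc of_nat_diff flip: power_add)
    qed
    have "real (\<Prod>i<t. p i) * b ^ (q * t) = (\<Prod>i<t. real (p i) * b ^ q)"
      by (simp add: prod.distrib power_mult)
    also have "\<dots> \<le> (\<Prod>i<t. real q * b ^ p i)"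
      using b by (intro prod_mono) (auto intro!: tangent)
    also have "\<dots> = real q ^ t * b ^ d"
      by (simp add: prod.distrib d_def power_sum)
    also have "\<dots> = (real q ^ t * b ^ r) * b ^ (q * t)"
      by (simp add: d power_add)
    finally have "real (\<Prod>i<t. p i) \<le> real q ^ t * b ^ r"
      using b by simp
    \<comment> \<open>Each of the \<open>r\<close> factors \<open>b\<close> turns one
      \<open>q\<close> into \<open>q * b = q + 1\<close>.\<close>
    also have "real q ^ t = real q ^ (t - r) * real q ^ r"
      using r by (simp flip: power_add)
    also have "real q ^ (t - r) * real q ^ r * b ^ r = real q ^ (t - r) * (real q + 1) ^ r"
      using q by (simp add: b_def power_divide)
    finally have "(\<Prod>i<t. p i) \<le> q ^ (t - r) * (q + 1) ^ r"
      by (metis (mono_tags) of_nat_1 of_nat_add of_nat_le_iff of_nat_mult of_nat_power)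
    also have "\<dots> = (\<Prod>i<t - r. q) * (\<Prod>i = t - r..<t. q + 1)"
      using r by simp
    \<comment> \<open>The quotient is \<open>q\<close> at the first \<open>t - r\<close> indices and
      \<open>q + 1\<close> at the last \<open>r\<close>.\<close>
    also have "\<dots> = (\<Prod>i<t - r. (d + i) div t) * (\<Prod>i = t - r..<t. (d + i) div t)"
    proof -
      have eq: "(d + i) div t = q + (r + i) div t" for i
        using t by (simp add: d add.assoc)
      have "(r + i) div t = 1" if "t - r \<le> i" "i < t" for i
        using that r by (intro div_nat_eqI) auto
      moreover have "(r + i) div t = 0" if "i < t - r" for i
        using that by simp
      ultimately show ?thesis
        by (simp add: eq)
    qed
    also have "\<dots> = (\<Prod>i<t. (d + i) div t)"
      using prod.atLeastLessThan_concat[of 0 "t - r" t] by (simp add: atLeast0LessThan)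
    finally show ?thesis
      by (simp add: d_def)
  qed
qed

text \<open>
  Let \<open>v\<close> lie in the maximal number of cliques of size \<open>t + 1\<close>.  Each such clique leaves the
  neighborhood \<open>N\<close> of \<open>v\<close>, so there are at most \<open>card (A - N)\<close> times as many as cliques of size \<open>t\<close>
  in \<open>N\<close>.
\<close>

lemma card_cliques_le_prod:
  assumes "finite A" and "\<And>H. H \<in> [A]\<^bsup>Suc t\<^esup> \<Longrightarrow> \<not> clique H E"
  shows "\<exists>p. sum p {..<t} = card A \<and> card {H \<in> [A]\<^bsup>t\<^esup>. clique H E} \<le> prod p {..<t}"
  using assms
proof (induction t arbitrary: A)
  case 0
  have "A = {}"
  proof (rule ccontr)
    assume "A \<noteq> {}"
    then obtain x where "{x} \<in> [A]\<^bsup>Suc 0\<^esup>"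
      by (auto simp: nsets_one)
    with "0.prems" show False
      by (force simp: clique_def)
  qed
  moreover have "{H. H = {} \<and> clique H E} = {{}}"
    by auto
  ultimately show ?case
    by simp
next
  case (Suc t)
  define C where "C u = {H \<in> [A]\<^bsup>Suc t\<^esup>. clique H E \<and> u \<in> H}" for u
  have fin: "finite (C u)" for u
    using Suc.prems(1) by (simp add: C_def finite_imp_finite_nsets)
  show ?case
  proof (cases "A = {}")
    case True
    then show ?thesis
      by (intro exI[of _ "\<lambda>_. 0"]) (simp add: nsets_empty_iff)
  next
    case False
    have "Max ((\<lambda>u. card (C u)) ` A) \<in> (\<lambda>u. card (C u)) ` A"
      using False Suc.prems(1) by simp
    then obtain v where "v \<in> A" and "Max ((\<lambda>u. card (C u)) ` A) = card (C v)"
      by auto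
    then have v: "v \<in> A" "\<And>u. u \<in> A \<Longrightarrow> card (C u) \<le> card (C v)"
      using Suc.prems(1) by (metis Max_ge finite_imageI imageI)+
    define N where "N = {u \<in> A. u \<noteq> v \<and> {v, u} \<in> E}"
    have N: "finite N" "N \<subseteq> A" "v \<notin> N"
      using Suc.prems(1) by (auto simp: N_def)
    have free: "\<not> clique H E" if "H \<in> [N]\<^bsup>Suc t\<^esup>" for H
    proof
      assume "clique H E"
      then have "clique (insert v H) E"
        using that by (auto simp: clique_def N_def nsets_def insert_commute)
      moreover have "insert v H \<in> [A]\<^bsup>Suc (Suc t)\<^esup>"
        using that N v(1) by (auto simp: nsets_def card_insert_if)
      ultimately show False
        using Suc.prems(2) by blast
    qed
    obtain p where p: "sum p {..<t} = card N"
        "card {H \<in> [N]\<^bsup>t\<^esup>. clique H E} \<le> prod p {..<t}"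
      using Suc.IH[OF N(1) free] by blast
    have "card (C v) \<le> card {H \<in> [N]\<^bsup>t\<^esup>. clique H E}"
    proof (rule card_inj_on_le)
      show "inj_on (\<lambda>H. H - {v}) (C v)"
        by (rule inj_onI) (auto simp: C_def)
      show "(\<lambda>H. H - {v}) ` C v \<subseteq> {H \<in> [N]\<^bsup>t\<^esup>. clique H E}"
        using v(1) by (auto simp: C_def N_def nsets_def clique_def)
    qed (use N in \<open>simp add: finite_imp_finite_nsets\<close>)
    with p(2) have Cv: "card (C v) \<le> prod p {..<t}"
      by simp
    have "{H \<in> [A]\<^bsup>Suc t\<^esup>. clique H E} \<subseteq> (\<Union>u\<in>A - N. C u)"
    proof
      fix H assume H: "H \<in> {H \<in> [A]\<^bsup>Suc t\<^esup>. clique H E}"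
      then have "\<not> H \<subseteq> N"
        using free by (auto simp: nsets_def)
      then show "H \<in> (\<Union>u\<in>A - N. C u)"
        using H by (auto simp: C_def nsets_def)
    qed
    then have "card {H \<in> [A]\<^bsup>Suc t\<^esup>. clique H E} \<le> card (\<Union>u\<in>A - N. C u)"
      using Suc.prems(1) fin by (intro card_mono) auto
    also have "\<dots> \<le> (\<Sum>u\<in>A - N. card (C u))"
      using Suc.prems(1) by (intro card_UN_le) auto
    also have "\<dots> \<le> (\<Sum>u\<in>A - N. prod p {..<t})"
      using v(2) Cv by (intro sum_mono) (meson DiffD1 le_trans)
    also have "\<dots> = (card A - card N) * prod p {..<t}"
      using N by (simp add: card_Diff_subset)
    \<comment> \<open>The new part \<open>A - N\<close> gets index \<open>t\<close>, so the part
      sizes sum to \<open>card A\<close>.\<close>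
    finally show ?thesis
      using p(1) N Suc.prems(1) card_mono[of A N]
      by (intro exI[of _ "p(t := card A - card N)"]) (simp add: mult.commute)
  qed
qed

text \<open>For \<open>t > 0\<close> the factors are the part sizes of the Turan graph with
  \<open>t\<close> parts, so their product is its number of \<open>t\<close>-cliques.\<close>

lemma card_cliques_le_balanced:
  assumes "finite A" and "\<And>H. H \<in> [A]\<^bsup>Suc t\<^esup> \<Longrightarrow> \<not> clique H E"
  shows "card {H \<in> [A]\<^bsup>t\<^esup>. clique H E} \<le> (\<Prod>i<t. (card A + i) div t)"
proof -
  obtain p where "sum p {..<t} = card A" "card {H \<in> [A]\<^bsup>t\<^esup>. clique H E} \<le> prod p {..<t}"
    using card_cliques_le_prod[of A t E] assms by blast
  then show ?thesis
    using prod_le_balanced[of p t] by simp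
qed

text \<open>For an integer \<open>x\<close>, the ceiling of \<open>x / t\<close> is the floor of
  \<open>(x + t - 1) / t\<close>; reversing the order of the factors then matches the
  indices.\<close>

lemma prod_ceiling_eq:
  assumes "t > 0"
  shows "(\<Prod>j = 0..t - 1. \<lceil>(real d - real j) / real t\<rceil>) = int (\<Prod>i<t. (d + i) div t)"
proof -
  have "\<lceil>(real d - real j) / real t\<rceil> = int ((d + (t - Suc j)) div t)" if "j < t" for j
  proof -
    define n where "n = d + (t - Suc j)"
    \<comment> \<open>Division with remainder writes \<open>d - j\<close> as a multiple of
      \<open>t\<close> plus a rest between 1 and \<open>t\<close>, which fixes the ceiling.\<close>
    have "real n = real (n div t) * real t + real (n mod t)"
      by (metis of_nat_add of_nat_mult div_mult_mod_eq)
    then have "real d - real j = (real (n div t) - 1) * real t + (real (n mod t) + 1)"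
      using that by (simp add: n_def of_nat_diff algebra_simps)
    moreover have "real (n mod t) + 1 \<le> real t"
      using mod_less_divisor[OF assms, of n] by linarith
    ultimately have "(real (n div t) - 1) * real t < real d - real j"
      and "real d - real j \<le> (real (n div t) - 1) * real t + real t"
      by simp_all
    then show ?thesis
      unfolding n_def[symmetric] using assms
      by (intro ceiling_unique) (simp_all add: pos_less_divide_eq pos_divide_le_eq left_diff_distrib)
  qed
  then have "(\<Prod>j<t. \<lceil>(real d - real j) / real t\<rceil>) = (\<Prod>j<t. int ((d + (t - Suc j)) div t))"
    by (intro prod.cong) auto
  also have "\<dots> = (\<Prod>i<t. int ((d + i) div t))"
    by (rule prod.nat_diff_reindex)
  moreover have "{0..t - 1} = {..<t}"
    using assms by auto
  ultimately show ?thesis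
    by simp
qed

section \<open>Ramsey numbers and color neighborhoods\<close>

lemma partn_lst_image:
  assumes "partn_lst A s \<gamma>" "inj_on g A" "g ` A \<subseteq> B"
  shows "partn_lst B s \<gamma>"
  unfolding partn_lst_def
proof
  fix f assume "f \<in> [B]\<^bsup>\<gamma>\<^esup> \<rightarrow> {..<length s}"
  then have "f \<circ> (`) g \<in> [A]\<^bsup>\<gamma>\<^esup> \<rightarrow> {..<length s}"
    using assms by (intro nsets_compose_image_funcset) auto
  then obtain i H where i: "i < length s" and H: "H \<in> [A]\<^bsup>(s ! i)\<^esup>"
      "(f \<circ> (`) g) ` [H]\<^bsup>\<gamma>\<^esup> \<subseteq> {i}"
    using assms(1) unfolding partn_lst_def monochromatic_def by blast
  have inj: "inj_on g H"
    using H(1) assms(2) by (auto simp: nsets_def intro: inj_on_subset)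
  have "(`) g ` [H]\<^bsup>\<gamma>\<^esup> = [g ` H]\<^bsup>\<gamma>\<^esup>"
    using bij_betw_nsets[OF inj_on_imp_bij_betw[OF inj]] by (simp add: bij_betw_def)
  then have "f ` [g ` H]\<^bsup>\<gamma>\<^esup> \<subseteq> {i}"
    using H(2) by (metis image_comp)
  moreover have "g ` H \<in> [B]\<^bsup>(s ! i)\<^esup>"
    using H(1) inj assms(3) by (auto simp: nsets_def card_image)
  ultimately show "\<exists>i<length s. monochromatic B (s ! i) \<gamma> f i"
    using i unfolding monochromatic_def by blast
qed

lemma partn_lst_ramsey_number_le:
  assumes "finite A" "ramsey_number s \<le> card A"
  shows "partn_lst A s 2"
proof -
  obtain g where "bij_betw g {0..<card A} A"
    using assms(1) ex_bij_betw_nat_finite by blast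
  then have "inj_on g {..<ramsey_number s}" "g ` {..<ramsey_number s} \<subseteq> A"
    using assms(2) by (auto simp: bij_betw_def inj_on_def)
  then show ?thesis
    using partn_lst_image[OF partn_lst_ramsey_number] by blast
qed

text \<open>Turns a color class into the edge set of a graph, so that the clique counts
  apply.\<close>

lemma monochromatic_iff_clique:
  "monochromatic V m 2 f i \<longleftrightarrow> (\<exists>H\<in>[V]\<^bsup>m\<^esup>. clique H (f -` {i}))"
proof -
  have "f ` [H]\<^bsup>2\<^esup> \<subseteq> {i} \<longleftrightarrow> clique H (f -` {i})" for H
    by (auto simp: clique_def nsets_2_eq)
  then show ?thesis
    by (simp add: monochromatic_def)
qed

definition color_neighbors :: "'a set \<Rightarrow> ('a set \<Rightarrow> nat) \<Rightarrow> 'a \<Rightarrow> nat \<Rightarrow> 'a set" where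
  "color_neighbors V f v i = {u \<in> V. u \<noteq> v \<and> f {v, u} = i}"

text \<open>A clique of color \<open>i\<close> among the color-\<open>i\<close> neighbors of
  \<open>v\<close> could be enlarged by \<open>v\<close>.\<close>

lemma color_neighbors_clique_free:
  assumes "\<not> monochromatic V (Suc m) 2 f i" "v \<in> V" "H \<in> [color_neighbors V f v i]\<^bsup>m\<^esup>"
  shows "\<not> clique H (f -` {i})"
proof
  assume "clique H (f -` {i})"
  then have "clique (insert v H) (f -` {i})"
    using assms(3) by (auto simp: clique_def color_neighbors_def nsets_def insert_commute)
  moreover have "insert v H \<in> [V]\<^bsup>Suc m\<^esup>"
    using assms(2,3) by (auto simp: nsets_def card_insert_if color_neighbors_def)
  ultimately show False
    using assms(1) by (auto simp: monochromatic_iff_clique)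
qed

lemma sum_card_color_neighbors:
  assumes "finite V" "v \<in> V" "f \<in> [V]\<^bsup>2\<^esup> \<rightarrow> {..<k}"
  shows "(\<Sum>i<k. card (color_neighbors V f v i)) = card V - 1"
proof -
  have "V - {v} = (\<Union>i<k. color_neighbors V f v i)"
    using assms(2,3) by (fastforce simp: color_neighbors_def Pi_iff)
  moreover have "card (\<Union>i<k. color_neighbors V f v i) = (\<Sum>i<k. card (color_neighbors V f v i))"
    using assms(1) by (intro card_UN_disjoint) (auto simp: color_neighbors_def)
  ultimately show ?thesis
    using assms(1,2) by (metis card_Diff_singleton)
qed

lemma length_remove_nth: "a < length xs \<Longrightarrow> length (remove_nth a xs) = length xs - 1"
  by (simp add: remove_nth_def)

lemma nth_remove_nth:
  "a < length xs \<Longrightarrow> c < length xs - 1 \<Longrightarrow> remove_nth a xs ! c = xs ! (if c < a then c else Suc c)"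
  by (auto simp: remove_nth_def nth_append min_def)

text \<open>A set of vertices that spans no edge of color \<open>a\<close> is colored by the remaining colors only.\<close>

lemma card_color_neighbors_less:
  assumes "finite V" and f: "f \<in> [V]\<^bsup>2\<^esup> \<rightarrow> {..<length s}"
    and mono: "\<And>i. i < length s \<Longrightarrow> \<not> monochromatic V (s ! i) 2 f i"
    and a: "a < length s" "s ! a > 0" and v: "v \<in> V"
  shows "card (color_neighbors V f v a)
    < ramsey_number [s ! a - 1, ramsey_number (remove_nth a s)]"
proof (rule ccontr)
  define N where "N = color_neighbors V f v a"
  define Q where "Q = ramsey_number (remove_nth a s)"
  assume "\<not> ?thesis"
  moreover have N: "finite N" "N \<subseteq> V"
    using assms(1) by (auto simp: N_def color_neighbors_def)
  ultimately have "partn_lst N [s ! a - 1, Q] 2"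
    by (intro partn_lst_ramsey_number_le) (simp_all add: N_def Q_def)
  \<comment> \<open>All colors other than \<open>a\<close> are merged into color 1, and
    \<open>a\<close> becomes 0.\<close>
  moreover define c where "c e = (if f e = a then 0 else Suc 0)" for e
  moreover have "c \<in> [N]\<^bsup>2\<^esup> \<rightarrow> {..<length [s ! a - 1, Q]}"
    by (simp add: c_def)
  ultimately obtain i where "i < length [s ! a - 1, Q]"
    "monochromatic N ([s ! a - 1, Q] ! i) 2 c i"
    unfolding partn_lst_def by blast
  then consider "monochromatic N (s ! a - 1) 2 c 0" | "monochromatic N Q 2 c (Suc 0)"
    by (auto simp: less_Suc_eq)
  then show False
  proof cases
    case 1
    moreover have "c -` {0} = f -` {a}"
      by (auto simp: c_def split: if_splits)
    ultimately obtain H where "H \<in> [N]\<^bsup>(s ! a - 1)\<^esup>" "clique H (f -` {a})"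
      by (auto simp: monochromatic_iff_clique)
    moreover have "\<not> monochromatic V (Suc (s ! a - 1)) 2 f a"
      using mono a by simp
    ultimately show False
      using color_neighbors_clique_free[of V "s ! a - 1" f a v H] v by (simp add: N_def)
  next
    case 2
    then obtain H where H: "H \<in> [N]\<^bsup>Q\<^esup>" "clique H (c -` {Suc 0})"
      by (auto simp: monochromatic_iff_clique)
    have HV: "H \<subseteq> V" "finite H" "card H = Q"
      using H(1) N by (auto simp: nsets_def)
    have not_a: "f e \<noteq> a" if "e \<in> [H]\<^bsup>2\<^esup>" for e
    proof -
      have "c e = Suc 0"
        using that H(2) by (auto simp: clique_def nsets_2_eq)
      then show ?thesis
        by (auto simp: c_def)
    qed
    \<comment> \<open>Renumbering closes the gap left by color \<open>a\<close>, matching the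
      indices of \<open>remove_nth a s\<close>; \<open>j'\<close> undoes it.\<close>
    define h where "h e = (if f e < a then f e else f e - 1)" for e
    have "h e < length s - 1" if e: "e \<in> [H]\<^bsup>2\<^esup>" for e
    proof -
      have "f e < length s"
        using f e nsets_mono[OF HV(1)] by blast
      with not_a[OF e] a(1) show ?thesis
        by (auto simp: h_def)
    qed
    then have "h \<in> [H]\<^bsup>2\<^esup> \<rightarrow> {..<length (remove_nth a s)}"
      by (simp add: length_remove_nth a(1))
    moreover have "partn_lst H (remove_nth a s) 2"
      using HV by (intro partn_lst_ramsey_number_le) (simp_all add: Q_def)
    ultimately obtain j where j: "j < length s - 1" "monochromatic H (remove_nth a s ! j) 2 h j"
      using a(1) by (auto simp: partn_lst_def length_remove_nth)
    define j' where "j' = (if j < a then j else Suc j)"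
    have j': "j' < length s" "remove_nth a s ! j = s ! j'"
      using j(1) a(1) by (auto simp: j'_def nth_remove_nth)
    from j(2) obtain K where K: "K \<in> [H]\<^bsup>(s ! j')\<^esup>" "clique K (h -` {j})"
      by (auto simp: monochromatic_iff_clique j')
    have "f {x, y} = j'" if "x \<in> K" "y \<in> K" "x \<noteq> y" for x y
    proof -
      have "{x, y} \<in> [H]\<^bsup>2\<^esup>" "h {x, y} = j"
        using that K by (auto simp: nsets_def clique_def)
      then show ?thesis
        using not_a[of "{x, y}"] by (auto simp: h_def j'_def split: if_splits)
    qed
    then have "clique K (f -` {j'})"
      by (simp add: clique_def)
    moreover have "K \<in> [V]\<^bsup>(s ! j')\<^esup>"
      using K(1) HV(1) nsets_mono by blast
    ultimately show False
      using mono[OF j'(1)] by (auto simp: monochromatic_iff_clique)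
  qed
qed

section \<open>Duplicating a vertex\<close>

text \<open>
  The vertex \<open>n\<close> is a twin of \<open>v\<close>: contracting the pair shows that a monochromatic clique must
  contain both of them, so it has the color \<open>i\<close> of their edge and the rest of it lies in the
  neighborhood of \<open>v\<close> in that color.
\<close>

lemma ex_twin_coloring:
  assumes f: "f \<in> edge_colorings n (length s)"
    and mono: "\<And>i. i < length s \<Longrightarrow> \<not> monochromatic {..<n} (s ! i) 2 f i"
    and v: "v < n" and i: "i < length s"
  shows "\<exists>f' \<in> edge_colorings (Suc n) (length s). card (monochromatic_subgraphs (Suc n) s f')
    \<le> card {H \<in> [color_neighbors {..<n} f v i]\<^bsup>(s ! i - 2)\<^esup>. clique H (f -` {i})}"
proof
  \<comment> \<open>\<open>g\<close> sends both twins to \<open>v\<close> and collapses the edge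
    \<open>{v, n}\<close>, whose color is therefore set separately.\<close>
  define g where "g u = (if u = n then v else u)" for u
  define f' where "f' e = (if e = {v, n} then i else f (g ` e))" for e
  have "f' {x, y} < length s" if "x < Suc n" "y < Suc n" "x \<noteq> y" for x y
  proof (cases "{x, y} = {v, n}")
    case True
    then show ?thesis
      using i by (simp add: f'_def)
  next
    case False
    then have "{g x, g y} \<in> [{..<n}]\<^bsup>2\<^esup>"
      using that v by (auto simp: g_def)
    then have "f {g x, g y} < length s"
      using f by (auto simp: edge_colorings_def Pi_iff)
    with False show ?thesis
      by (simp add: f'_def)
  qed
  then show "f' \<in> edge_colorings (Suc n) (length s)"
    by (auto simp: edge_colorings_def nsets_2_eq)
  define N where "N = color_neighbors {..<n} f v i"
  have key: "v \<in> H \<and> n \<in> H \<and> H - {v, n} \<in> [N]\<^bsup>(s ! i - 2)\<^esup> \<and> clique (H - {v, n}) (f -` {i})"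
    if j: "j < length s" and H: "H \<in> [{..<Suc n}]\<^bsup>(s ! j)\<^esup>" "f' ` [H]\<^bsup>2\<^esup> \<subseteq> {j}" for H j
  proof -
    have f'j: "f' {x, y} = j" if "x \<in> H" "y \<in> H" "x \<noteq> y" for x y
      using that H(2) by (auto simp: image_subset_iff)
    have vn: "v \<in> H \<and> n \<in> H"
    proof (rule ccontr)
      assume not: "\<not> (v \<in> H \<and> n \<in> H)"
      then have "inj_on g H"
        by (auto simp: inj_on_def g_def)
      then have "card (g ` H) = s ! j"
        using H(1) by (simp add: nsets_def card_image)
      then have "g ` H \<in> [{..<n}]\<^bsup>(s ! j)\<^esup>"
        using H(1) v by (auto simp: nsets_def g_def)
      moreover have "f {g x, g y} = j" if "x \<in> H" "y \<in> H" "g x \<noteq> g y" for x y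
      proof -
        have "{x, y} \<noteq> {v, n}"
          using that not by (auto simp: doubleton_eq_iff)
        then show ?thesis
          using f'j[of x y] that by (auto simp: f'_def)
      qed
      then have "clique (g ` H) (f -` {j})"
        by (auto simp: clique_def)
      ultimately show False
        using mono[OF j] by (auto simp: monochromatic_iff_clique)
    qed
    then have [simp]: "j = i"
      using f'j[of v n] v by (simp add: f'_def)
    \<comment> \<open>Only \<open>n\<close> is excluded: the pairs containing \<open>v\<close> place
      the rest of \<open>H\<close> in the neighborhood of \<open>v\<close>.\<close>
    have f_eq: "f {x, y} = i" if "x \<in> H - {n}" "y \<in> H - {n}" "x \<noteq> y" for x y
    proof -
      have "{x, y} \<noteq> {v, n}"
        using that by (auto simp: doubleton_eq_iff)
      then show ?thesis
        using f'j[of x y] that by (simp add: f'_def g_def)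
    qed
    have "u \<in> N" if "u \<in> H - {v, n}" for u
      using that H(1) f_eq[of v u] vn v
      by (force simp: N_def color_neighbors_def nsets_def)
    moreover have "card (H - {v, n}) = s ! i - 2"
      using H(1) vn v by (subst card_Diff_subset) (auto simp: nsets_def)
    ultimately have "H - {v, n} \<in> [N]\<^bsup>(s ! i - 2)\<^esup>"
      using H(1) by (auto simp: nsets_def)
    moreover have "clique (H - {v, n}) (f -` {i})"
      using f_eq by (auto simp: clique_def)
    ultimately show ?thesis
      using vn by blast
  qed
  show "card (monochromatic_subgraphs (Suc n) s f')
    \<le> card {H \<in> [color_neighbors {..<n} f v i]\<^bsup>(s ! i - 2)\<^esup>. clique H (f -` {i})}"
  proof (rule card_inj_on_le)
    \<comment> \<open>Both twins lie in every counted clique, so deleting them loses nothing, and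
      \<open>H\<close> determines \<open>E\<close>.\<close>
    show "inj_on (\<lambda>(H, E). H - {v, n}) (monochromatic_subgraphs (Suc n) s f')"
    proof (rule inj_onI, clarify)
      fix H E H' E'
      assume HE: "(H, E) \<in> monochromatic_subgraphs (Suc n) s f'"
        "(H', E') \<in> monochromatic_subgraphs (Suc n) s f'"
        and eq: "H - {v, n} = H' - {v, n}"
      have "v \<in> H \<and> n \<in> H" "v \<in> H' \<and> n \<in> H'"
        using HE key unfolding monochromatic_subgraphs_def by blast+
      with eq have "H = H'"
        by blast
      with HE show "H = H' \<and> E = E'"
        by (auto simp: monochromatic_subgraphs_def)
    qed
    show "(\<lambda>(H, E). H - {v, n}) ` monochromatic_subgraphs (Suc n) s f'
      \<subseteq> {H \<in> [color_neighbors {..<n} f v i]\<^bsup>(s ! i - 2)\<^esup>. clique H (f -` {i})}"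
      using key unfolding N_def[symmetric] monochromatic_subgraphs_def by fast
  qed (simp add: finite_imp_finite_nsets color_neighbors_def)
qed

section \<open>Critical multiplicity and admissible sizes\<close>

lemma finite_monochromatic_subgraphs: "finite (monochromatic_subgraphs n s f)"
proof (rule finite_subset)
  show "monochromatic_subgraphs n s f \<subseteq> (\<lambda>H. (H, [H]\<^bsup>2\<^esup>)) ` Pow {..<n}"
    by (auto simp: monochromatic_subgraphs_def nsets_def)
qed simp

lemma card_monochromatic_subgraphs_pos:
  assumes "f \<in> edge_colorings (ramsey_number s) (length s)"
  shows "card (monochromatic_subgraphs (ramsey_number s) s f) > 0"
proof -
  obtain i H where "i < length s" "H \<in> [{..<ramsey_number s}]\<^bsup>(s ! i)\<^esup>" "f ` [H]\<^bsup>2\<^esup> \<subseteq> {i}"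
    using partn_lst_ramsey_number[of s] assms
    unfolding partn_lst_def monochromatic_def edge_colorings_def by blast
  then have "(H, [H]\<^bsup>2\<^esup>) \<in> monochromatic_subgraphs (ramsey_number s) s f"
    by (auto simp: monochromatic_subgraphs_def)
  then show ?thesis
    using finite_monochromatic_subgraphs card_gt_0_iff by blast
qed

text \<open>The greatest lower bound is attained: 0 is a lower bound, and the count for any one
  coloring bounds all of them.\<close>

lemma critical_multiplicity_le:
  assumes "f \<in> edge_colorings (ramsey_number s) (length s)"
  shows "critical_multiplicity s \<le> card (monochromatic_subgraphs (ramsey_number s) s f)"
proof -
  let ?P = "\<lambda>M. \<forall>f \<in> edge_colorings (ramsey_number s) (length s).
    M \<le> card (monochromatic_subgraphs (ramsey_number s) s f)"
  have "?P (Greatest ?P)"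
    using assms by (intro GreatestI_nat[of ?P 0]) auto
  then show ?thesis
    using assms unfolding critical_multiplicity_def by blast
qed

text \<open>Makes the maximum over these sizes meaningful; each entry is at most the bounded
  sum.\<close>

lemma finite_admissible_sizes: "finite (admissible_sizes s)"
proof (rule finite_subset)
  define M where "M = ramsey_number s + 2 * (length s - 1)"
  show "admissible_sizes s \<subseteq> {n. set n \<subseteq> {..M} \<and> length n = length s}"
    using member_le_sum_list by (fastforce simp: admissible_sizes_def M_def)
  show "finite {n. set n \<subseteq> {..M} \<and> length n = length s}"
    by (simp add: finite_lists_length_eq)
qed

section \<open>The bound obtained from twins of a single vertex\<close>

theorem theorem3p7:
  fixes k :: nat and s :: "nat list"
  assumes "k \<ge> 2" and "length s = k" and "\<forall>i<k. s ! i \<ge> 3"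
  shows "int (critical_multiplicity s) \<le>
    Max {MIN i\<in>{..<k}. \<Prod>j = 0..s ! i - 3.
           \<lceil>((real (n ! i) - 2) - real j) / (real (s ! i) - 2)\<rceil> | n. n \<in> admissible_sizes s}"
proof -
  note [simp] = \<open>length s = k\<close>
  define R where "R = ramsey_number s"
  define m where "m = R - 1"
  \<comment> \<open>The constant coloring yields a clique on at least 3 vertices, so
    \<open>m > 0\<close> and vertex 0 is there to be duplicated.\<close>
  have "(\<lambda>_. 0) \<in> edge_colorings R (length s)"
    using assms(1) by (simp add: edge_colorings_def)
  then obtain i H where "i < k" "H \<in> [{..<R}]\<^bsup>(s ! i)\<^esup>"
    using partn_lst_ramsey_number[of s]
    unfolding partn_lst_def monochromatic_def edge_colorings_def R_def by fastforce
  then have "R \<ge> 3"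
    using assms(3) card_mono[of "{..<R}" H] by (fastforce simp: nsets_def)
  then have R: "R = Suc m" "m \<ge> 2"
    by (simp_all add: m_def)
  have "\<not> partn_lst {..<m} s 2"
    using R(1) not_less_Least[of m "\<lambda>n. partn_lst {..<n} s 2"]
    by (simp add: R_def ramsey_number_def)
  then obtain f where f: "f \<in> [{..<m}]\<^bsup>2\<^esup> \<rightarrow> {..<length s}"
    and mono: "\<And>i. i < length s \<Longrightarrow> \<not> monochromatic {..<m} (s ! i) 2 f i"
    unfolding partn_lst_def by blast
  define N where "N = color_neighbors {..<m} f 0"
  define d where "d i = card (N i)" for i
  have finN: "finite (N i)" for i
    by (simp add: N_def color_neighbors_def)
  have "0 < m"
    using R(2) by simp
  define C where "C i = {H \<in> [N i]\<^bsup>(s ! i - 2)\<^esup>. clique H (f -` {i})}" for i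
  have twin: "\<exists>f' \<in> edge_colorings R k. card (monochromatic_subgraphs R s f') \<le> card (C i)"
    if "i < k" for i
    using ex_twin_coloring[of f m s 0 i] f mono \<open>0 < m\<close> that
    by (simp add: edge_colorings_def R(1) C_def N_def)
  have bound: "critical_multiplicity s \<le> (\<Prod>j<s ! i - 2. (d i + j) div (s ! i - 2))" if i: "i < k" for i
  proof -
    have "\<not> clique H (f -` {i})" if "H \<in> [N i]\<^bsup>Suc (s ! i - 2)\<^esup>" for H
    proof (rule color_neighbors_clique_free)
      have "Suc (Suc (s ! i - 2)) = s ! i"
        using assms(3)[rule_format, OF i] by arith
      then show "\<not> monochromatic {..<m} (Suc (Suc (s ! i - 2))) 2 f i"
        using mono i by simp
    qed (use that \<open>0 < m\<close> in \<open>simp_all add: N_def\<close>)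
    then have "card (C i) \<le> (\<Prod>j<s ! i - 2. (d i + j) div (s ! i - 2))"
      unfolding C_def d_def by (intro card_cliques_le_balanced finN)
    moreover obtain f' where "f' \<in> edge_colorings R k"
      "card (monochromatic_subgraphs R s f') \<le> card (C i)"
      using twin i by blast
    moreover have "critical_multiplicity s \<le> card (monochromatic_subgraphs R s f')"
      using critical_multiplicity_le[of f' s] \<open>f' \<in> _\<close> by (simp add: R_def)
    ultimately show ?thesis
      by linarith
  qed
  \<comment> \<open>Otherwise \<open>C i\<close> is empty and the twin coloring has no monochromatic
    clique, although it lives on \<open>R\<close> vertices.\<close>
  have size: "s ! i \<le> d i + 2" if i: "i < k" for i
  proof -
    obtain f' where "f' \<in> edge_colorings R k"
      "card (monochromatic_subgraphs R s f') \<le> card (C i)"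
      using twin i by blast
    moreover from this have "card (monochromatic_subgraphs R s f') > 0"
      using card_monochromatic_subgraphs_pos[of f' s] by (simp add: R_def)
    ultimately have "C i \<noteq> {}"
      by (metis card.empty leD)
    then have "[N i]\<^bsup>(s ! i - 2)\<^esup> \<noteq> {}"
      by (auto simp: C_def)
    then show ?thesis
      using finN nsets_eq_empty[of "N i" "s ! i - 2"] by (fastforce simp: d_def)
  qed
  have degree: "d a < ramsey_number [s ! a - 1, ramsey_number (remove_nth a s)]" if "a < k" for a
    using card_color_neighbors_less[OF _ f mono, of a 0] assms(3) that \<open>0 < m\<close>
    by (force simp: d_def N_def)
  define n where "n = map (\<lambda>i. d i + 2) [0..<k]"
  have length_n: "length n = k"
    by (simp add: n_def)
  have n: "n ! i = d i + 2" if "i < k" for i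
    using that by (simp add: n_def)
  \<comment> \<open>The \<open>m - 1 = R - 2\<close> neighbors plus 2 per color meet the sum
    condition with equality.\<close>
  have "sum_list n = (\<Sum>i<k. d i + 2)"
    by (simp add: n_def interv_sum_list_conv_sum_set_nat atLeast0LessThan)
  also have "\<dots> = (m - 1) + 2 * k"
    using sum_card_color_neighbors[of "{..<m}" 0 f k] f \<open>0 < m\<close>
    by (simp add: sum.distrib d_def N_def del: add_2_eq_Suc')
  also have "\<dots> = R + 2 * (k - 1)"
    using R assms(1) by simp
  finally have sum: "sum_list n = R + 2 * (k - 1)" .
  have "n \<in> admissible_sizes s"
  proof -
    have "\<bar>int (n ! i) - int (n ! j)\<bar>
        < int (ramsey_number [s ! a - 1, ramsey_number (remove_nth a s)]) - (int (s ! b) - 2)"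
      if ij: "i < k" "j < k" "{a, b} = {i, j}" "n ! a = max (n ! i) (n ! j)" for i j a b
    proof -
      have ab: "a < k" "b < k"
        using ij by (auto simp: doubleton_eq_iff)
      \<comment> \<open>The larger degree \<open>d a\<close> is below the Ramsey number, and
        \<open>d b\<close> is at least \<open>s ! b - 2\<close>.\<close>
      have "\<bar>int (n ! i) - int (n ! j)\<bar> = int (d a) - int (d b)"
        using ij n by (auto simp: doubleton_eq_iff max_def split: if_splits)
      with degree[OF ab(1)] size[OF ab(2)] show ?thesis
        by linarith
    qed
    then show ?thesis
      unfolding admissible_sizes_def using sum size n by (simp add: R_def length_n)
  qed
  define F where "F n = (MIN i\<in>{..<k}. \<Prod>j = 0..s ! i - 3.
    \<lceil>((real (n ! i) - 2) - real j) / (real (s ! i) - 2)\<rceil>)" for n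
  \<comment> \<open>All colors share one vertex and thus one \<open>n\<close>, so the bound holds
    for each \<open>i\<close> and hence for the minimum.\<close>
  have "int (critical_multiplicity s) \<le> F n"
    unfolding F_def
  proof (rule Min.boundedI)
    fix x
    assume "x \<in> (\<lambda>i. \<Prod>j = 0..s ! i - 3.
      \<lceil>((real (n ! i) - 2) - real j) / (real (s ! i) - 2)\<rceil>) ` {..<k}"
    then obtain i where i: "i < k"
      and x: "x = (\<Prod>j = 0..s ! i - 3. \<lceil>((real (n ! i) - 2) - real j) / (real (s ! i) - 2)\<rceil>)"
      by auto
    have si: "3 \<le> s ! i"
      using assms(3) i by blast
    then have eqs: "real (s ! i) - 2 = real (s ! i - 2)" "s ! i - 3 = (s ! i - 2) - 1"
      by (simp_all add: of_nat_diff)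
    have "real (n ! i) - 2 = real (d i)"
      using n[OF i] by simp
    then have "x = (\<Prod>j = 0..(s ! i - 2) - 1. \<lceil>(real (d i) - real j) / real (s ! i - 2)\<rceil>)"
      by (simp only: x eqs)
    also have "\<dots> = int (\<Prod>j<s ! i - 2. (d i + j) div (s ! i - 2))"
      using si by (intro prod_ceiling_eq) simp
    finally show "int (critical_multiplicity s) \<le> x"
      using bound[OF i] by (simp only: of_nat_le_iff)
  qed (use assms(1) in \<open>auto simp: lessThan_empty_iff\<close>)
  also have "F n \<le> Max {F n | n. n \<in> admissible_sizes s}"
  proof (rule Max_ge)
    show "finite {F n | n. n \<in> admissible_sizes s}"
      using finite_admissible_sizes[of s] by (intro finite_image_set) simp
  qed (use \<open>n \<in> admissible_sizes s\<close> in blast)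
  finally show ?thesis
    by (simp add: F_def)
qed

end
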